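(* Let $M\ge 2$ be a fixed integer and let $\kappa_1,\kappa_2\in\mathbb{R}$ satisfy $\kappa_1>0$ and $\kappa_1+4\kappa_2>0$. Let $\Theta$ be the memory kernel of the generalized Langevin equation for the one-dimensional lattice with first and second neighbor force constants $\kappa_1,\kappa_2$, where the coarse-grained variables are defined by piecewise constant weighting functions with block size $M$. Explicitly, for $J\in\mathbb Z$, $$\Theta_{0,J}(0)=\frac{1}{2\pi}\int_0^{2\pi} e^{iJ\xi}\,Q_1^{\intercal}\widehat{\mathcal A}(\xi)Q_2\left(Q_2^{\intercal}\widehat{\mathcal A}(\xi)Q_2\right)^{-1}Q_2^{\intercal}\widehat{\mathcal A}(\xi)Q_1\,d\xi .$$ Then for every positive integer $n$, $$|\Theta_{0,J}(0)|= o\left(|J|^{-n}\right)\quad\text{as } |J|\to\infty .$$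
   Context: Lattice operator. Set $\kappa_0=2(\kappa_1+\kappa_2)$ and let $\mathcal A$ act on $\ell^2(\mathbb Z)$ by $(\mathcal A u)_j=-\kappa_2u_{j-2}-\kappa_1u_{j-1}+\kappa_0u_j-\kappa_1u_{j+1}-\kappa_2u_{j+2}$. Grouping the sites into consecutive blocks of $M$ sites, $\mathcal A$ becomes a block tridiagonal block Toeplitz operator with $M\times M$ blocks: diagonal block $A_0$, sub-diagonal block $A_1$, super-diagonal block $A_{-1}=A_1^{\intercal}$. Here $(A_0)_{ij}=\kappa_0$ if $i=j$, $-\kappa_1$ if $|i-j|=1$, $-\kappa_2$ if $|i-j|=2$, and $0$ otherwise; the only nonzero entries of $A_1$ are $A_1(1,M)=-\kappa_1$ and $A_1(1,M-1)=A_1(2,M)=-\kappa_2$. The Fourier transform (symbol) is $$\widehat{\mathcal A}(\xi)=A_0+e^{-i\xi}A_1+e^{i\xi}A_1^{\intercal},\qquad \xi\in(0,2\pi].$$ Piecewise constant averaging. $Q_1=\frac{1}{\sqrt M}(1,1,\dots,1)^{\intercal}\in\mathbb R^M$, and $Q_2\in\mathbb R^{M\times(M-1)}$ is any matrix such that $[Q_1\;Q_2]$ is an orthogonal $M\times M$ matrix. The averaging operator $\Phi$ is block diagonal with diagonal block $Q_1$, and $\Psi$ is block diagonal with diagonal block $Q_2$. Kernel. The memory kernel is $\Theta(t)=\Phi^{\intercal}\mathcal A\Psi\cos(\Omega t)\Omega^{-2}\Psi^{\intercal}\mathcal A\Phi$ with $\Omega^2=\Psi^{\intercal}\mathcal A\Psi$;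 its $(0,J)$ entry at $t=0$ (indices labelling blocks) is the integral displayed in the claim. *)

theory Defs
  imports
    "HOL-Analysis.Analysis"
    "HOL-Library.Landau_Symbols"
    "Jordan_Normal_Form.Gauss_Jordan_Elimination"
begin

text \<open>
  Matrix indices are zero-based: the entry written $(r,s)$ in one-based notation is
  the entry \<open>(r - 1, s - 1)\<close> below.
\<close>

definition diag_block :: "real \<Rightarrow> real \<Rightarrow> nat \<Rightarrow> real mat" where
  "diag_block \<kappa>1 \<kappa>2 M = mat M M (\<lambda>(i, j).
     if i = j then 2 * (\<kappa>1 + \<kappa>2)
     else if \<bar>int i - int j\<bar> = 1 then - \<kappa>1
     else if \<bar>int i - int j\<bar> = 2 then - \<kappa>2
     else 0)"

definition subdiag_block :: "real \<Rightarrow> real \<Rightarrow> nat \<Rightarrow> real mat" where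
  "subdiag_block \<kappa>1 \<kappa>2 M = mat M M (\<lambda>(i, j).
     if (i, j) = (0, M - 1) then - \<kappa>1
     else if (i, j) = (0, M - 2) \<or> (i, j) = (1, M - 1) then - \<kappa>2
     else 0)"

abbreviation cmat :: "real mat \<Rightarrow> complex mat" where
  "cmat \<equiv> map_mat complex_of_real"

definition symbol :: "real \<Rightarrow> real \<Rightarrow> nat \<Rightarrow> real \<Rightarrow> complex mat" where
  "symbol \<kappa>1 \<kappa>2 M \<xi> =
     cmat (diag_block \<kappa>1 \<kappa>2 M)
     + exp (- \<i> * of_real \<xi>) \<cdot>\<^sub>m cmat (subdiag_block \<kappa>1 \<kappa>2 M)
     + exp (\<i> * of_real \<xi>) \<cdot>\<^sub>m cmat (transpose_mat (subdiag_block \<kappa>1 \<kappa>2 M))"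

definition avg_col :: "nat \<Rightarrow> real mat" where
  "avg_col M = mat M 1 (\<lambda>_. 1 / sqrt (real M))"

definition append_cols :: "'a::zero mat \<Rightarrow> 'a mat \<Rightarrow> 'a mat" where
  "append_cols A B = four_block_mat A B (0\<^sub>m 0 (dim_col A)) (0\<^sub>m 0 (dim_col B))"

text \<open>
  Orthogonal in the usual sense, i.e. with orthonormal columns; the library predicate
  \<^const>\<open>orthogonal_mat\<close> does not require the columns to have length 1.
\<close>

definition is_orthogonal_matrix :: "nat \<Rightarrow> real mat \<Rightarrow> bool" where
  "is_orthogonal_matrix m U \<longleftrightarrow>
     U \<in> carrier_mat m m \<and> transpose_mat U * U = 1\<^sub>m m \<and> U * transpose_mat U = 1\<^sub>m m"

definition is_complement :: "nat \<Rightarrow> real mat \<Rightarrow> bool" where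
  "is_complement M Q2 \<longleftrightarrow>
     Q2 \<in> carrier_mat M (M - 1) \<and> is_orthogonal_matrix M (append_cols (avg_col M) Q2)"

text \<open>
  The integrand at \<open>t = 0\<close> is the single entry of a \<open>1 \<times> 1\<close> matrix. The call to
  \<^const>\<open>the\<close> returns an unspecified matrix where the argument is singular; for
  \<open>\<kappa>1 > 0\<close> and \<open>\<kappa>1 + 4 * \<kappa>2 > 0\<close> the symbol compressed to the range of \<open>Q2\<close> is
  positive definite for every \<open>\<xi>\<close>, so this case does not occur.
\<close>

definition kernel_symbol :: "real \<Rightarrow> real \<Rightarrow> nat \<Rightarrow> real mat \<Rightarrow> real \<Rightarrow> complex" where
  "kernel_symbol \<kappa>1 \<kappa>2 M Q2 \<xi> =
     (let A = symbol \<kappa>1 \<kappa>2 M \<xi>; R1 = cmat (avg_col M); R2 = cmat Q2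
      in (transpose_mat R1 * A * R2
          * the (mat_inverse (transpose_mat R2 * A * R2))
          * (transpose_mat R2 * A * R1)) $$ (0, 0))"

text \<open>\<open>memory_kernel0 \<kappa>1 \<kappa>2 M Q2 J\<close> is the block entry $(0,J)$ of the kernel at time 0.\<close>

definition memory_kernel0 :: "real \<Rightarrow> real \<Rightarrow> nat \<Rightarrow> real mat \<Rightarrow> int \<Rightarrow> complex" where
  "memory_kernel0 \<kappa>1 \<kappa>2 M Q2 J =
     1 / (2 * of_real pi) *
     integral {0..2 * pi} (\<lambda>\<xi>. exp (\<i> * of_int J * of_real \<xi>) * kernel_symbol \<kappa>1 \<kappa>2 M Q2 \<xi>)"

end

theory Submission
  imports Defs "Jordan_Normal_Form.Determinant"
begin

text \<open>
  The entries of the compressed symbol are Laurent polynomials in \<open>cis \<xi>\<close>. Extending a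
  block vector \<open>u\<close> quasi-periodically with multiplier \<open>cis \<xi>\<close>, the Hermitian form of the
  symbol becomes \<open>\<kappa>1 * (\<Sum>\<bar>d\<^sub>i\<bar>\<^sup>2) + \<kappa>2 * (\<Sum>\<bar>d\<^sub>i + d\<^sub>i\<^sub>+\<^sub>1\<bar>\<^sup>2)\<close> with forward differences
  \<open>d\<^sub>i = u\<^sub>i\<^sub>+\<^sub>1 - u\<^sub>i\<close>; it dominates a positive multiple of \<open>\<Sum>\<bar>d\<^sub>i\<bar>\<^sup>2\<close>, so it vanishes only
  on constant vectors, which the range of \<open>Q2\<close> excludes. By Cramer's rule the kernel symbol is
  then a rational function of \<open>cis \<xi>\<close> without poles on the unit circle. This class of periodic
  functions is closed under differentiation, so repeated integration by parts bounds the Fourier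
  coefficients by every power of \<open>1 / \<bar>J\<bar>\<close>.
\<close>

section \<open>Fourier coefficients of rational functions on the unit circle\<close>

text \<open>Negative powers of \<open>cis x\<close> are absorbed into \<open>q\<close>, so Laurent
  polynomials are covered. Zeros of \<open>q\<close> are excluded on the unit circle only.\<close>

definition trig_rational :: "(real \<Rightarrow> complex) \<Rightarrow> bool" where
  "trig_rational f \<longleftrightarrow> (\<exists>p q. \<forall>x. poly q (cis x) \<noteq> 0 \<and> f x = poly p (cis x) / poly q (cis x))"

lemma trig_rationalI:
  assumes "\<And>x. poly q (cis x) \<noteq> 0" "\<And>x. f x = poly p (cis x) / poly q (cis x)"
  shows "trig_rational f"
  using assms unfolding trig_rational_def by blast

lemma trig_rationalE:
  assumes "trig_rational f"
  obtains p q where "\<And>x. poly q (cis x) \<noteq> 0" "\<And>x. f x = poly p (cis x) / poly q (cis x)"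
  using assms unfolding trig_rational_def by blast

lemma trig_rational_const: "trig_rational (\<lambda>x. c)"
  by (rule trig_rationalI[of 1 _ "[:c:]"]) auto

lemma trig_rational_cis: "trig_rational (\<lambda>x. cis x)"
  by (rule trig_rationalI[of 1 _ "[:0, 1:]"]) auto

lemma trig_rational_cis_minus: "trig_rational (\<lambda>x. cis (- x))"
  by (rule trig_rationalI[of "[:0, 1:]" _ 1]) (auto simp: cis_neq_zero cis_inverse divide_inverse)

lemma trig_rational_add:
  assumes "trig_rational f" "trig_rational g"
  shows "trig_rational (\<lambda>x. f x + g x)"
proof -
  obtain p q where f: "\<And>x. poly q (cis x) \<noteq> 0" "\<And>x. f x = poly p (cis x) / poly q (cis x)"
    using assms(1) trig_rationalE by metis
  obtain r s where g: "\<And>x. poly s (cis x) \<noteq> 0" "\<And>x. g x = poly r (cis x) / poly s (cis x)"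
    using assms(2) trig_rationalE by metis
  show ?thesis
    by (rule trig_rationalI[of "q * s" _ "p * s + r * q"]) (use f g in \<open>auto simp: add_frac_eq\<close>)
qed

lemma trig_rational_mult:
  assumes "trig_rational f" "trig_rational g"
  shows "trig_rational (\<lambda>x. f x * g x)"
proof -
  obtain p q where f: "\<And>x. poly q (cis x) \<noteq> 0" "\<And>x. f x = poly p (cis x) / poly q (cis x)"
    using assms(1) trig_rationalE by metis
  obtain r s where g: "\<And>x. poly s (cis x) \<noteq> 0" "\<And>x. g x = poly r (cis x) / poly s (cis x)"
    using assms(2) trig_rationalE by metis
  show ?thesis
    by (rule trig_rationalI[of "q * s" _ "p * r"]) (use f g in auto)
qed

lemma trig_rational_divide:
  assumes "trig_rational f" "trig_rational g" and nz: "\<And>x. g x \<noteq> 0"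
  shows "trig_rational (\<lambda>x. f x / g x)"
proof -
  obtain p q where f: "\<And>x. poly q (cis x) \<noteq> 0" "\<And>x. f x = poly p (cis x) / poly q (cis x)"
    using assms(1) trig_rationalE by metis
  obtain r s where g: "\<And>x. poly s (cis x) \<noteq> 0" "\<And>x. g x = poly r (cis x) / poly s (cis x)"
    using assms(2) trig_rationalE by metis
  have "poly r (cis x) \<noteq> 0" for x using nz[of x] g by auto
  then show ?thesis
    by (intro trig_rationalI[of "q * r" _ "p * s"]) (use f g in auto)
qed

lemma trig_rational_sum:
  assumes "\<And>i. i \<in> I \<Longrightarrow> trig_rational (f i)"
  shows "trig_rational (\<lambda>x. \<Sum>i\<in>I. f i x)"
  using assms
  by (induction I rule: infinite_finite_induct) (auto intro: trig_rational_const trig_rational_add)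

lemma trig_rational_prod:
  assumes "\<And>i. i \<in> I \<Longrightarrow> trig_rational (f i)"
  shows "trig_rational (\<lambda>x. \<Prod>i\<in>I. f i x)"
  using assms
  by (induction I rule: infinite_finite_induct) (auto intro: trig_rational_const trig_rational_mult)

lemma trig_rational_periodic:
  assumes "trig_rational f"
  shows "f (x + 2 * pi) = f x"
proof -
  have "cis (x + 2 * pi) = cis x" by (simp flip: cis_mult)
  then show ?thesis using assms by (auto simp: trig_rational_def)
qed

text \<open>Chain rule through \<open>cis\<close> and quotient rule: the new denominator
  \<open>q * q\<close> still has no zero on the unit circle, so differentiation stays in the class
  and can be iterated.\<close>

lemma trig_rational_has_derivative:
  assumes "trig_rational f"
  obtains f' where "trig_rational f'" "\<And>x. (f has_vector_derivative f' x) (at x)"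
proof -
  obtain p q where f: "\<And>x. poly q (cis x) \<noteq> 0" "\<And>x. f x = poly p (cis x) / poly q (cis x)"
    using assms trig_rationalE by metis
  define f' where "f' x = (\<i> * cis x) * (poly (pderiv p * q - p * pderiv q) (cis x) / poly (q * q) (cis x))" for x
  have "trig_rational f'"
    unfolding f'_def
    by (intro trig_rational_mult trig_rational_const trig_rational_cis trig_rationalI[OF _ refl])
       (use f in auto)
  moreover have "(f has_vector_derivative f' x) (at x)" for x
  proof -
    have c: "(cis has_vector_derivative \<i> * cis x) (at x)"
      unfolding cis_conv_exp[abs_def]
      by (auto intro!: derivative_eq_intros has_vector_derivative_real_field)
    have "((\<lambda>z. poly p z / poly q z) has_field_derivative
       poly (pderiv p * q - p * pderiv q) (cis x) / poly (q * q) (cis x)) (at (cis x))"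
      using f(1)[of x] by (auto intro!: derivative_eq_intros)
    from field_vector_diff_chain_at[OF c this] show ?thesis
      unfolding f(2)[abs_def] f'_def by (simp add: o_def)
  qed
  ultimately show thesis by (rule that)
qed

lemma trig_rational_continuous_on:
  assumes "trig_rational f"
  shows "continuous_on S f"
  by (metis assms continuous_at_imp_continuous_on has_vector_derivative_continuous trig_rational_has_derivative)

text \<open>Integration by parts over one period; the boundary terms cancel because \<open>J\<close>
  is an integer and \<open>f\<close> is periodic. Multiplying by \<open>J\<close> instead of
  dividing keeps \<open>J = 0\<close> included.\<close>

lemma trig_rational_fourier_parts:
  assumes f: "trig_rational f" "trig_rational f'" "\<And>x. (f has_vector_derivative f' x) (at x)"
  shows "of_int J * integral {0..2 * pi} (\<lambda>x. cis (of_int J * x) * f x)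
       = \<i> * integral {0..2 * pi} (\<lambda>x. cis (of_int J * x) * f' x)"
proof -
  let ?e = "\<lambda>x. cis (of_int J * x)"
  have e: "(?e has_vector_derivative (\<i> * of_int J) * ?e x) (at x)" for x
    unfolding cis_conv_exp
    by (auto intro!: derivative_eq_intros has_vector_derivative_real_field simp: algebra_simps)
  have ce: "continuous_on S ?e" for S
    using e by (meson continuous_at_imp_continuous_on has_vector_derivative_continuous)
  have d: "((\<lambda>x. ?e x * f x) has_vector_derivative (?e x * f' x + (\<i> * of_int J) * (?e x * f x))) (at x)" for x
    using has_vector_derivative_mult[OF e f(3)] by (simp add: mult.assoc)
  have "((\<lambda>x. ?e x * f' x + (\<i> * of_int J) * (?e x * f x)) has_integral
           (?e (2 * pi) * f (2 * pi) - ?e 0 * f 0)) {0..2 * pi}"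
    by (intro fundamental_theorem_of_calculus has_vector_derivative_at_within[OF d]) simp
  moreover have "?e (2 * pi) = 1"
    by (rule complex_eqI) (use cos_int_2pin[of J] sin_int_2pin[of J] in \<open>auto simp: mult_ac\<close>)
  moreover have "f (2 * pi) = f 0" using trig_rational_periodic[OF f(1), of 0] by simp
  ultimately have "integral {0..2 * pi} (\<lambda>x. ?e x * f' x + (\<i> * of_int J) * (?e x * f x)) = 0"
    by (simp add: integral_unique)
  moreover have "integral {0..2 * pi} (\<lambda>x. ?e x * f' x + (\<i> * of_int J) * (?e x * f x))
     = integral {0..2 * pi} (\<lambda>x. ?e x * f' x) + (\<i> * of_int J) * integral {0..2 * pi} (\<lambda>x. ?e x * f x)"
    by (subst integral_add)
       (auto intro!: integrable_continuous_interval continuous_on_mult continuous_on_const ce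
          trig_rational_continuous_on[OF f(1)] trig_rational_continuous_on[OF f(2)])
  ultimately have "integral {0..2 * pi} (\<lambda>x. ?e x * f' x) = - (\<i> * of_int J) * integral {0..2 * pi} (\<lambda>x. ?e x * f x)"
    by (simp add: eq_neg_iff_add_eq_0)
  then show ?thesis by (simp add: algebra_simps flip: mult.assoc)
qed

text \<open>Each integration by parts trades one power of \<open>\<bar>J\<bar>\<close> for one
  derivative, which is why the induction on \<open>k\<close> has to leave \<open>f\<close>
  arbitrary. For \<open>k = 0\<close>, continuity on a compact period suffices.\<close>

lemma trig_rational_fourier_bound:
  assumes "trig_rational f"
  shows "\<exists>C. \<forall>J::int. \<bar>of_int J\<bar> ^ k * cmod (integral {0..2 * pi} (\<lambda>x. cis (of_int J * x) * f x)) \<le> C"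
  using assms
proof (induction k arbitrary: f)
  case 0
  then have "bounded (f ` {0..2 * pi})"
    by (intro compact_imp_bounded compact_continuous_image trig_rational_continuous_on) auto
  then obtain B where B: "\<And>x. x \<in> {0..2 * pi} \<Longrightarrow> cmod (f x) \<le> B"
    unfolding bounded_iff by blast
  have "cmod (integral {0..2 * pi} (\<lambda>x. cis (of_int J * x) * f x)) \<le> B * (2 * pi - 0)" for J :: int
    by (intro integral_bound continuous_intros trig_rational_continuous_on 0)
       (use B in \<open>auto simp: norm_mult\<close>)
  then show ?case by (intro exI[of _ "B * (2 * pi)"]) simp
next
  case (Suc k)
  obtain f' where f': "trig_rational f'" "\<And>x. (f has_vector_derivative f' x) (at x)"
    using trig_rational_has_derivative[OF Suc.prems] by metis
  obtain C where C: "\<And>J::int. \<bar>of_int J\<bar> ^ k * cmod (integral {0..2 * pi} (\<lambda>x. cis (of_int J * x) * f' x)) \<le> C"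
    using Suc.IH[OF f'(1)] by blast
  have "\<bar>of_int J\<bar> ^ Suc k * cmod (integral {0..2 * pi} (\<lambda>x. cis (of_int J * x) * f x)) \<le> C" for J :: int
  proof -
    have "\<bar>of_int J\<bar> * cmod (integral {0..2 * pi} (\<lambda>x. cis (of_int J * x) * f x))
        = cmod (integral {0..2 * pi} (\<lambda>x. cis (of_int J * x) * f' x))"
      using arg_cong[OF trig_rational_fourier_parts[OF Suc.prems f', of J], of cmod]
      by (simp add: norm_mult)
    then show ?thesis using C[of J] by (simp only: power_Suc2 mult.assoc)
  qed
  then show ?case by blast
qed

text \<open>The bound for the exponent \<open>Suc n\<close> leaves a spare factor
  \<open>1 / \<bar>J\<bar>\<close>, which turns boundedness into little-o. The filter lets
  \<open>J\<close> tend to either infinity.\<close>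

lemma trig_rational_fourier_smallo:
  assumes "trig_rational f"
  shows "(\<lambda>J. norm (c * integral {0..2 * pi} (\<lambda>x. cis (of_int J * x) * f x)))
           \<in> o[filtercomap (\<lambda>J::int. \<bar>J\<bar>) at_top](\<lambda>J. real_of_int \<bar>J\<bar> powi (- int n))"
proof (rule landau_o.smallI)
  fix \<epsilon> :: real assume "\<epsilon> > 0"
  obtain C where C: "\<And>J::int. \<bar>of_int J\<bar> ^ Suc n * cmod (integral {0..2 * pi} (\<lambda>x. cis (of_int J * x) * f x)) \<le> C"
    using trig_rational_fourier_bound[OF assms, of "Suc n"] by blast
  \<comment> \<open>The ceiling makes \<open>cmod c * C / \<bar>J\<bar>\<close> at most
    \<open>\<epsilon>\<close>; the maximum with 1 keeps \<open>\<bar>J\<bar>\<close> positive for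
    the cancellations below.\<close>
  define N where "N = max 1 \<lceil>cmod c * C / \<epsilon>\<rceil>"
  show "\<forall>\<^sub>F J in filtercomap (\<lambda>J::int. \<bar>J\<bar>) at_top.
      norm (norm (c * integral {0..2 * pi} (\<lambda>x. cis (of_int J * x) * f x)))
        \<le> \<epsilon> * norm (real_of_int \<bar>J\<bar> powi (- int n))"
    unfolding eventually_filtercomap_at_top_linorder
  proof (intro exI[of _ N] allI impI)
    fix J :: int assume J: "N \<le> \<bar>J\<bar>"
    let ?I = "integral {0..2 * pi} (\<lambda>x. cis (of_int J * x) * f x)"
    define a where "a = real_of_int \<bar>J\<bar>"
    have a: "a \<ge> 1" "a \<ge> cmod c * C / \<epsilon>" using J unfolding N_def a_def max.bounded_iff ceiling_le_iff by linarith+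
    have "a ^ n * a * (cmod c * cmod ?I) = cmod c * (\<bar>of_int J\<bar> ^ Suc n * cmod ?I)"
      by (simp add: a_def mult_ac)
    also have "\<dots> \<le> cmod c * C" by (intro mult_left_mono C) auto
    also have "\<dots> \<le> \<epsilon> * a" using a(2) \<open>\<epsilon> > 0\<close> by (simp add: field_simps)
    finally have "a * (a ^ n * (cmod c * cmod ?I)) \<le> a * \<epsilon>" by (simp add: mult_ac)
    then have "a ^ n * (cmod c * cmod ?I) \<le> \<epsilon>" using a(1) by simp
    then have "cmod c * cmod ?I \<le> \<epsilon> / a ^ n" using a(1) by (simp add: field_simps)
    then show "norm (norm (c * ?I)) \<le> \<epsilon> * norm (real_of_int \<bar>J\<bar> powi (- int n))"
      unfolding a_def[symmetric] using a(1) by (simp add: norm_mult power_int_minus divide_inverse)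
  qed
qed

section \<open>Matrices with trigonometric rational entries: products, determinants,
  inverses\<close>

definition trig_rational_mat :: "nat \<Rightarrow> nat \<Rightarrow> (real \<Rightarrow> complex mat) \<Rightarrow> bool" where
  "trig_rational_mat m n F \<longleftrightarrow> (\<forall>x. F x \<in> carrier_mat m n) \<and>
     (\<forall>i<m. \<forall>j<n. trig_rational (\<lambda>x. F x $$ (i, j)))"

lemma trig_rational_matI:
  assumes "\<And>x. F x \<in> carrier_mat m n" "\<And>i j. i < m \<Longrightarrow> j < n \<Longrightarrow> trig_rational (\<lambda>x. F x $$ (i, j))"
  shows "trig_rational_mat m n F"
  using assms by (simp add: trig_rational_mat_def)

lemma trig_rational_matD:
  assumes "trig_rational_mat m n F"
  shows "F x \<in> carrier_mat m n" "i < m \<Longrightarrow> j < n \<Longrightarrow> trig_rational (\<lambda>x. F x $$ (i, j))"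
  using assms by (simp_all add: trig_rational_mat_def)

lemma trig_rational_mat_const: "A \<in> carrier_mat m n \<Longrightarrow> trig_rational_mat m n (\<lambda>x. A)"
  by (simp add: trig_rational_mat_def trig_rational_const)

lemma trig_rational_mat_mult:
  assumes "trig_rational_mat l m F" "trig_rational_mat m n G"
  shows "trig_rational_mat l n (\<lambda>x. F x * G x)"
proof (rule trig_rational_matI)
  show "F x * G x \<in> carrier_mat l n" for x
    using assms[THEN trig_rational_matD(1)] by (rule mult_carrier_mat)
  fix i j assume ij: "i < l" "j < n"
  have "(F x * G x) $$ (i, j) = (\<Sum>k\<in>{0..<m}. F x $$ (i, k) * G x $$ (k, j))" for x
    using assms[THEN trig_rational_matD(1), of x] ij
    by (auto simp: scalar_prod_def)
  then show "trig_rational (\<lambda>x. (F x * G x) $$ (i, j))"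
    using ij assms by (auto intro!: trig_rational_sum trig_rational_mult trig_rational_matD(2))
qed

text \<open>By the Leibniz formula the determinant is a finite sum of finite products of
  entries.\<close>

lemma trig_rational_det:
  assumes "trig_rational_mat n n F"
  shows "trig_rational (\<lambda>x. Determinant.det (F x))"
proof -
  have "trig_rational (\<lambda>x. \<Sum>p | p permutes {0..<n}. signof p * (\<Prod>i = 0..<n. F x $$ (i, p i)))"
    by (intro trig_rational_sum trig_rational_mult trig_rational_const trig_rational_prod
        trig_rational_matD(2)[OF assms]) (auto dest: permutes_in_image)
  then show ?thesis
    using det_def'[OF trig_rational_matD(1)[OF assms]] by simp
qed

lemma trig_rational_mat_adj:
  assumes "trig_rational_mat n n F"
  shows "trig_rational_mat n n (\<lambda>x. adj_mat (F x))"
proof (rule trig_rational_matI)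
  note F = trig_rational_matD(1)[OF assms]
  show "adj_mat (F x) \<in> carrier_mat n n" for x by (rule adj_mat(1)[OF F])
  fix i j assume ij: "i < n" "j < n"
  have "trig_rational_mat (n - 1) (n - 1) (\<lambda>x. mat_delete (F x) j i)"
  proof (rule trig_rational_matI)
    show "mat_delete (F x) j i \<in> carrier_mat (n - 1) (n - 1)" for x
      by (rule mat_delete_carrier[OF F])
    fix a b assume ab: "a < n - 1" "b < n - 1"
    \<comment> \<open>Deleting row \<open>j\<close> and column \<open>i\<close> shifts later indices
      by one, so each entry of the minor sits at a position of \<open>F x\<close> that is the same
      for all \<open>x\<close>.\<close>
    have "mat_delete (F x) j i $$ (a, b) =
        F x $$ (if a < j then a else Suc a, if b < i then b else Suc b)" for x
      using F[of x] ab by (simp add: mat_delete_def)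
    then show "trig_rational (\<lambda>x. mat_delete (F x) j i $$ (a, b))"
      using ab by (simp add: trig_rational_matD(2)[OF assms])
  qed
  then have "trig_rational (\<lambda>x. (-1) ^ (j + i) * Determinant.det (mat_delete (F x) j i))"
    by (intro trig_rational_mult trig_rational_const trig_rational_det)
  moreover have "adj_mat (F x) $$ (i, j) = (-1) ^ (j + i) * Determinant.det (mat_delete (F x) j i)" for x
    using F[of x] ij by (simp add: adj_mat_def cofactor_def)
  ultimately show "trig_rational (\<lambda>x. adj_mat (F x) $$ (i, j))" by simp
qed

text \<open>\<open>mat_inverse\<close> runs Gauss-Jordan elimination, which gives no uniform formula
  for the entries. Uniqueness of inverses identifies its result with Cramer's formula, which is
  rational in the entries of \<open>A\<close>.\<close>

lemma mat_inverse_eq_adj_mat: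
  fixes A :: "'a::field mat"
  assumes A: "A \<in> carrier_mat n n" and det: "Determinant.det A \<noteq> 0"
  shows "the (mat_inverse A) = inverse (Determinant.det A) \<cdot>\<^sub>m adj_mat A"
proof -
  let ?B = "inverse (Determinant.det A) \<cdot>\<^sub>m adj_mat A"
  note adj = adj_mat[OF A]
  have B: "?B \<in> carrier_mat n n" "A * ?B = 1\<^sub>m n"
    using adj det by (auto simp: mult_smult_distrib[OF A adj(1)] intro!: eq_matI)
  \<comment> \<open>A nonzero determinant makes \<open>A\<close> a unit of the matrix ring, which
    rules out the result \<open>None\<close>.\<close>
  obtain C where C: "mat_inverse A = Some C"
    using mat_inverse(1)[OF A, where b = "()"] det_non_zero_imp_unit[OF A det] by fastforce
  have CA: "C * A = 1\<^sub>m n" "C \<in> carrier_mat n n"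
    using mat_inverse(2)[OF A C] by auto
  \<comment> \<open>The left inverse \<open>C\<close> and the right inverse \<open>?B\<close> of
    \<open>A\<close> must coincide.\<close>
  have "?B = (C * A) * ?B" unfolding CA(1) by (rule left_mult_one_mat[OF B(1), symmetric])
  also have "\<dots> = C * (A * ?B)" by (rule assoc_mult_mat[OF CA(2) A B(1)])
  also have "\<dots> = C" unfolding B(2) using CA(2) by simp
  finally show ?thesis using C by simp
qed

lemma trig_rational_mat_inverse:
  assumes F: "trig_rational_mat n n F" and det: "\<And>x. Determinant.det (F x) \<noteq> 0"
  shows "trig_rational_mat n n (\<lambda>x. the (mat_inverse (F x)))"
proof (rule trig_rational_matI)
  note adj = trig_rational_mat_adj[OF F]
  have eq: "the (mat_inverse (F x)) = inverse (Determinant.det (F x)) \<cdot>\<^sub>m adj_mat (F x)" for x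
    by (rule mat_inverse_eq_adj_mat[OF trig_rational_matD(1)[OF F] det])
  show "the (mat_inverse (F x)) \<in> carrier_mat n n" for x
    unfolding eq using trig_rational_matD(1)[OF adj] by simp
  fix i j assume ij: "i < n" "j < n"
  have "the (mat_inverse (F x)) $$ (i, j) = adj_mat (F x) $$ (i, j) / Determinant.det (F x)" for x
    unfolding eq using trig_rational_matD(1)[OF adj, of x] ij by (simp add: divide_inverse mult.commute)
  then show "trig_rational (\<lambda>x. the (mat_inverse (F x)) $$ (i, j))"
    using trig_rational_divide[OF trig_rational_matD(2)[OF adj ij] trig_rational_det[OF F] det] by simp
qed

section \<open>Definiteness of the symbol on mean-zero vectors\<close>

text \<open>Coupling of site \<open>i\<close> to its right neighbours \<open>i + 1\<close> and
  \<open>i + 2\<close>; a neighbour in the next block carries the multiplier \<open>z\<close>. For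
  \<open>M = 2\<close> the second-neighbour wraparound falls on the diagonal.\<close>

definition upper_coupling :: "real \<Rightarrow> real \<Rightarrow> nat \<Rightarrow> complex \<Rightarrow> nat \<Rightarrow> nat \<Rightarrow> complex" where
  "upper_coupling \<kappa>1 \<kappa>2 M z i j =
     - of_real \<kappa>1 * (of_bool (j = i + 1) + z * of_bool (i = M - 1 \<and> j = 0))
     - of_real \<kappa>2 * (of_bool (j = i + 2) + z * (of_bool (i = M - 2 \<and> j = 0) + of_bool (i = M - 1 \<and> j = 1)))"

lemma symbol_index:
  assumes "i < M" "j < M"
  shows "symbol \<kappa>1 \<kappa>2 M \<xi> $$ (i, j) =
    of_real (diag_block \<kappa>1 \<kappa>2 M $$ (i, j)) + cis (- \<xi>) * of_real (subdiag_block \<kappa>1 \<kappa>2 M $$ (i, j))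
      + cis \<xi> * of_real (subdiag_block \<kappa>1 \<kappa>2 M $$ (j, i))"
  using assms by (simp add: symbol_def diag_block_def subdiag_block_def cis_conv_exp)

text \<open>Coupling to the left is the adjoint of coupling to the right, as the force constants are
  real and \<open>cis (- \<xi>)\<close> is the conjugate of \<open>cis \<xi>\<close>.\<close>

lemma symbol_hermitian_split:
  assumes "M \<ge> 2" "i < M" "j < M"
  shows "symbol \<kappa>1 \<kappa>2 M \<xi> $$ (i, j) =
    of_real (2 * (\<kappa>1 + \<kappa>2)) * of_bool (i = j)
      + upper_coupling \<kappa>1 \<kappa>2 M (cis \<xi>) i j + cnj (upper_coupling \<kappa>1 \<kappa>2 M (cis \<xi>) j i)"
proof -
  have D: "diag_block \<kappa>1 \<kappa>2 M $$ (i, j) = 2 * (\<kappa>1 + \<kappa>2) * of_bool (i = j)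
     - \<kappa>1 * (of_bool (j = i + 1) + of_bool (i = j + 1)) - \<kappa>2 * (of_bool (j = i + 2) + of_bool (i = j + 2))"
    using assms by (auto simp: diag_block_def abs_if split: if_splits)
  \<comment> \<open>The three nonzero positions of the corner block are distinct for
    \<open>M \<ge> 2\<close>, so adding indicators agrees with the nested conditional.\<close>
  have S: "subdiag_block \<kappa>1 \<kappa>2 M $$ (i, j) = - \<kappa>1 * of_bool (j = M - 1 \<and> i = 0)
     - \<kappa>2 * (of_bool (j = M - 2 \<and> i = 0) + of_bool (j = M - 1 \<and> i = 1))" if "i < M" "j < M" for i j
    using assms(1) that by (auto simp: subdiag_block_def)
  have b: "cnj (of_bool P) = of_bool P" "complex_of_real (of_bool P) = of_bool P" for P
    by (cases P; simp)+
  show ?thesis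
    using assms
    by (simp only: symbol_index D S upper_coupling_def)
       (simp add: b cis_cnj algebra_simps)
qed

text \<open>A quasi-periodic (Bloch) sequence, continued over one further block only: for
  \<open>M \<ge> 2\<close> the indices that occur, at most \<open>M + 1\<close>, stay below
  \<open>2 * M\<close>.\<close>

definition bloch_extension :: "nat \<Rightarrow> complex \<Rightarrow> (nat \<Rightarrow> complex) \<Rightarrow> nat \<Rightarrow> complex" where
  "bloch_extension M z u j = (if j < M then u j else z * u (j - M))"

lemma sum_upper_coupling:
  assumes "M \<ge> 2" "i < M"
  shows "(\<Sum>j<M. upper_coupling \<kappa>1 \<kappa>2 M z i j * u j) =
    - of_real \<kappa>1 * bloch_extension M z u (i + 1) - of_real \<kappa>2 * bloch_extension M z u (i + 2)"
proof -
  have d: "(\<Sum>j<M. of_bool (P \<and> j = k) * u j) = (if P \<and> k < M then u k else 0)" for P k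
    by (cases P) (auto simp: of_bool_def if_distrib[of "\<lambda>x. x * _"] cong: if_cong)
  \<comment> \<open>The trivial guards \<open>True\<close> bring every indicator into the shape of
    \<open>d\<close>, which also drops neighbours outside the block.\<close>
  have "(\<Sum>j<M. upper_coupling \<kappa>1 \<kappa>2 M z i j * u j) =
     - of_real \<kappa>1 * ((\<Sum>j<M. of_bool (True \<and> j = i + 1) * u j)
                     + z * (\<Sum>j<M. of_bool (i = M - 1 \<and> j = 0) * u j))
     - of_real \<kappa>2 * ((\<Sum>j<M. of_bool (True \<and> j = i + 2) * u j)
         + z * ((\<Sum>j<M. of_bool (i = M - 2 \<and> j = 0) * u j) + (\<Sum>j<M. of_bool (i = M - 1 \<and> j = 1) * u j)))"
    unfolding upper_coupling_def sum_distrib_left sum.distrib[symmetric] sum_subtractf[symmetric]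
    by (intro sum.cong refl) (simp del: of_bool_conj add: algebra_simps)
  also have "\<dots> = - of_real \<kappa>1 * bloch_extension M z u (i + 1) - of_real \<kappa>2 * bloch_extension M z u (i + 2)"
  proof -
    \<comment> \<open>Neither right neighbour leaves the block, only the second one does, or both
      do.\<close>
    consider "i + 2 < M" | "i + 2 = M" | "i + 1 = M" using assms by linarith
    then show ?thesis
    proof cases
      case 1
      then have "i \<noteq> M - 1" "i \<noteq> M - 2" by linarith+
      then show ?thesis unfolding d bloch_extension_def using 1 by simp
    next
      case 2
      then have "i = M - 2" "i \<noteq> M - 1" "i + 1 < M" by linarith+
      then show ?thesis unfolding d bloch_extension_def using assms 2 by simp
    next
      case 3
      then have "i = M - 1" "i \<noteq> M - 2" "i + 2 - M = 1" "\<not> i + 2 < M" using assms by linarith+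
      then show ?thesis unfolding d bloch_extension_def using assms 3 by simp
    qed
  qed
  finally show ?thesis .
qed

lemma sum_Suc_eq_sum:
  fixes f :: "nat \<Rightarrow> real"
  assumes "f M = f 0"
  shows "(\<Sum>i<M. f (Suc i)) = (\<Sum>i<M. f i)"
  using sum.lessThan_Suc_shift[of f M] assms by simp

text \<open>On expanding the squared differences, the squared moduli add up to the diagonal term
  with coefficient \<open>2 * (\<kappa>1 + \<kappa>2)\<close>, and the cross terms are the neighbour
  couplings.\<close>

lemma Re_symbol_form:
  fixes u :: "nat \<Rightarrow> complex" and M :: nat
  defines "U \<equiv> \<lambda>\<xi>. bloch_extension M (cis \<xi>) u"
  assumes M: "M \<ge> 2"
  shows "Re (\<Sum>i<M. \<Sum>j<M. cnj (u i) * symbol \<kappa>1 \<kappa>2 M \<xi> $$ (i, j) * u j) =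
    \<kappa>1 * (\<Sum>i<M. (cmod (U \<xi> (i + 1) - U \<xi> i))\<^sup>2) + \<kappa>2 * (\<Sum>i<M. (cmod (U \<xi> (i + 2) - U \<xi> i))\<^sup>2)"
proof -
  define V where "V = U \<xi>"
  define L where "L = upper_coupling \<kappa>1 \<kappa>2 M (cis \<xi>)"
  have V: "V i = u i" if "i < M" for i using that by (simp add: V_def U_def bloch_extension_def)
  \<comment> \<open>As \<open>cis \<xi>\<close> has modulus 1, the sites entering a shifted window
    have the same moduli as those leaving it.\<close>
  have nV: "(\<Sum>i<M. (cmod (V (i + 1)))\<^sup>2) = (\<Sum>i<M. (cmod (V i))\<^sup>2)"
           "(\<Sum>i<M. (cmod (V (i + 2)))\<^sup>2) = (\<Sum>i<M. (cmod (V i))\<^sup>2)"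
  proof -
    have "cmod (V M) = cmod (V 0)" "cmod (V (M + 1)) = cmod (V 1)"
      using M by (auto simp: V_def U_def bloch_extension_def norm_mult)
    then have "(\<Sum>i<M. (cmod (V (Suc i)))\<^sup>2) = (\<Sum>i<M. (cmod (V i))\<^sup>2)"
       "(\<Sum>i<M. (cmod (V (Suc (Suc i))))\<^sup>2) = (\<Sum>i<M. (cmod (V (Suc i)))\<^sup>2)"
      using sum_Suc_eq_sum[of "\<lambda>i. (cmod (V i))\<^sup>2" M]
        sum_Suc_eq_sum[of "\<lambda>i. (cmod (V (Suc i)))\<^sup>2" M] by auto
    then show "(\<Sum>i<M. (cmod (V (i + 1)))\<^sup>2) = (\<Sum>i<M. (cmod (V i))\<^sup>2)"
           "(\<Sum>i<M. (cmod (V (i + 2)))\<^sup>2) = (\<Sum>i<M. (cmod (V i))\<^sup>2)" by simp_all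
  qed
  \<comment> \<open>\<open>W\<close> collects the couplings to the right. Exchanging the sums turns
    the couplings to the left into \<open>cnj W\<close>, so together they contribute
    \<open>2 * Re W\<close>.\<close>
  define W where "W = (\<Sum>i<M. cnj (u i) * (\<Sum>j<M. L i j * u j))"
  have "(\<Sum>i<M. \<Sum>j<M. cnj (u i) * symbol \<kappa>1 \<kappa>2 M \<xi> $$ (i, j) * u j) =
     (\<Sum>i<M. \<Sum>j<M. of_real (2 * (\<kappa>1 + \<kappa>2)) * (of_bool (i = j) * (cnj (u i) * u j)))
     + (\<Sum>i<M. \<Sum>j<M. cnj (u i) * (L i j * u j)) + (\<Sum>i<M. \<Sum>j<M. cnj (cnj (u j) * (L j i * u i)))"
    unfolding sum.distrib[symmetric]
    by (intro sum.cong refl) (simp add: symbol_hermitian_split M L_def algebra_simps)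
  moreover have "(\<Sum>i<M. \<Sum>j<M. cnj (cnj (u j) * (L j i * u i))) = cnj W"
    unfolding W_def by (subst sum.swap) (simp add: sum_distrib_left)
  moreover have "(\<Sum>i<M. \<Sum>j<M. cnj (u i) * (L i j * u j)) = W"
    unfolding W_def by (simp add: sum_distrib_left)
  moreover have "(\<Sum>i<M. \<Sum>j<M. of_real (2 * (\<kappa>1 + \<kappa>2)) * (of_bool (i = j) * (cnj (u i) * u j)))
      = of_real (\<Sum>i<M. 2 * (\<kappa>1 + \<kappa>2) * (cmod (u i))\<^sup>2)"
  proof -
    have "(\<Sum>j<M. of_real (2 * (\<kappa>1 + \<kappa>2)) * (of_bool (i = j) * (cnj (u i) * u j)))
        = of_real (2 * (\<kappa>1 + \<kappa>2) * (cmod (u i))\<^sup>2)" if "i < M" for i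
    proof -
      have "(\<Sum>j<M. of_real (2 * (\<kappa>1 + \<kappa>2)) * (of_bool (i = j) * (cnj (u i) * u j)))
          = of_real (2 * (\<kappa>1 + \<kappa>2)) * (cnj (u i) * u i)"
        using that by (auto simp: of_bool_def if_distrib if_distribR cong: if_cong)
      then show ?thesis by (simp only: of_real_mult complex_norm_square mult.commute)
    qed
    then show ?thesis unfolding of_real_sum by (rule sum.cong[OF refl]) (simp only: lessThan_iff)
  qed
  ultimately have form: "(\<Sum>i<M. \<Sum>j<M. cnj (u i) * symbol \<kappa>1 \<kappa>2 M \<xi> $$ (i, j) * u j)
      = of_real (\<Sum>i<M. 2 * (\<kappa>1 + \<kappa>2) * (cmod (u i))\<^sup>2) + W + cnj W"
    by (simp only:)
  have 1: "Re (\<Sum>i<M. \<Sum>j<M. cnj (u i) * symbol \<kappa>1 \<kappa>2 M \<xi> $$ (i, j) * u j)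
      = (\<Sum>i<M. 2 * (\<kappa>1 + \<kappa>2) * (cmod (u i))\<^sup>2) + 2 * Re W"
    unfolding form plus_complex.sel Re_complex_of_real cnj.sel by simp
  have W: "W = (\<Sum>i<M. - of_real \<kappa>1 * (cnj (V i) * V (i + 1)) - of_real \<kappa>2 * (cnj (V i) * V (i + 2)))"
  proof -
    have "(\<Sum>j<M. L i j * u j) = - of_real \<kappa>1 * V (i + 1) - of_real \<kappa>2 * V (i + 2)" if "i < M" for i
      unfolding L_def V_def U_def by (rule sum_upper_coupling[OF M that])
    then show ?thesis
      unfolding W_def by (intro sum.cong refl) (simp add: V right_diff_distrib mult.left_commute)
  qed
  have ReW: "Re W = - \<kappa>1 * (\<Sum>i<M. Re (cnj (V i) * V (i + 1))) - \<kappa>2 * (\<Sum>i<M. Re (cnj (V i) * V (i + 2)))"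
    unfolding W Re_sum sum_distrib_left sum_subtractf[symmetric]
    by (intro sum.cong refl) (simp add: algebra_simps)
  have sq: "(cmod (a - b))\<^sup>2 = (cmod a)\<^sup>2 + (cmod b)\<^sup>2 - 2 * Re (cnj b * a)" for a b
    unfolding cmod_power2 by (simp add: power2_eq_square algebra_simps)
  show ?thesis
  proof -
    have "(\<Sum>i<M. (cmod (V (i + 1) - V i))\<^sup>2)
        = 2 * (\<Sum>i<M. (cmod (V i))\<^sup>2) - 2 * (\<Sum>i<M. Re (cnj (V i) * V (i + 1)))"
      "(\<Sum>i<M. (cmod (V (i + 2) - V i))\<^sup>2)
        = 2 * (\<Sum>i<M. (cmod (V i))\<^sup>2) - 2 * (\<Sum>i<M. Re (cnj (V i) * V (i + 2)))"
      unfolding sq sum.distrib sum_subtractf nV by (simp_all only: sum_distrib_left[symmetric])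
    moreover have "(\<Sum>i<M. 2 * (\<kappa>1 + \<kappa>2) * (cmod (u i))\<^sup>2) = 2 * (\<kappa>1 + \<kappa>2) * (\<Sum>i<M. (cmod (V i))\<^sup>2)"
      unfolding sum_distrib_left by (intro sum.cong refl) (simp add: V)
    ultimately show ?thesis
      unfolding 1 ReW V_def[symmetric] by (simp add: distrib_left distrib_right right_diff_distrib)
  qed
qed

text \<open>A two-site difference is a sum of two consecutive one-site differences, so its square is
  at most twice the sum of their squares. The hypothesis closes the cycle, so both halves have equal
  sums: 2 + 2 gives the 4 of \<open>\<kappa>1 + 4 * \<kappa>2\<close>.\<close>

lemma sum_cmod_second_neighbour_le:
  fixes V :: "nat \<Rightarrow> complex"
  assumes "cmod (V (M + 1) - V M) = cmod (V 1 - V 0)"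
  shows "(\<Sum>i<M. (cmod (V (i + 2) - V i))\<^sup>2) \<le> 4 * (\<Sum>i<M. (cmod (V (i + 1) - V i))\<^sup>2)"
proof -
  define e where "e i = (cmod (V (i + 1) - V i))\<^sup>2" for i
  have "(cmod (V (i + 2) - V i))\<^sup>2 \<le> 2 * e (Suc i) + 2 * e i" for i
  proof -
    have "cmod (V (i + 2) - V i) \<le> cmod (V (i + 2) - V (i + 1)) + cmod (V (i + 1) - V i)" (is "?a \<le> ?b + ?c")
      using norm_triangle_ineq[of "V (i + 2) - V (i + 1)" "V (i + 1) - V i"] by simp
    then have "?a\<^sup>2 \<le> (?b + ?c)\<^sup>2" by (intro power_mono) auto
    also have "\<dots> \<le> 2 * ?b\<^sup>2 + 2 * ?c\<^sup>2"
      using sum_squares_bound[of ?b ?c] by (simp add: power2_sum)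
    finally show ?thesis by (simp add: e_def)
  qed
  then have "(\<Sum>i<M. (cmod (V (i + 2) - V i))\<^sup>2) \<le> (\<Sum>i<M. 2 * e (Suc i) + 2 * e i)"
    by (intro sum_mono)
  also have "\<dots> = 4 * (\<Sum>i<M. e i)"
    using sum_Suc_eq_sum[of e M] assms
    by (simp add: sum.distrib sum_distrib_left[symmetric] e_def)
  finally show ?thesis by (simp add: e_def)
qed

text \<open>A vanishing form forces all first differences to vanish, so \<open>u\<close> is constant
  on the block, and mean zero leaves only the zero vector.\<close>

lemma symbol_definite_on_mean_zero:
  fixes u :: "nat \<Rightarrow> complex"
  assumes M: "M \<ge> 2" and \<kappa>: "\<kappa>1 > 0" "\<kappa>1 + 4 * \<kappa>2 > 0"
    and form: "(\<Sum>i<M. \<Sum>j<M. cnj (u i) * symbol \<kappa>1 \<kappa>2 M \<xi> $$ (i, j) * u j) = 0"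
    and mean: "(\<Sum>i<M. u i) = 0" and "k < M"
  shows "u k = 0"
proof -
  define V where "V = bloch_extension M (cis \<xi>) u"
  define D where "D = (\<Sum>i<M. (cmod (V (i + 1) - V i))\<^sup>2)"
  define D2 where "D2 = (\<Sum>i<M. (cmod (V (i + 2) - V i))\<^sup>2)"
  have "cmod (V (M + 1) - V M) = cmod (V 1 - V 0)"
    using M by (simp add: V_def bloch_extension_def norm_mult flip: right_diff_distrib)
  then have D2: "D2 \<le> 4 * D"
    unfolding D_def D2_def by (rule sum_cmod_second_neighbour_le)
  have nonneg: "D \<ge> 0" "D2 \<ge> 0" by (auto simp: D_def D2_def sum_nonneg)
  have zero: "\<kappa>1 * D + \<kappa>2 * D2 = 0"
    using Re_symbol_form[OF M, of u \<kappa>1 \<kappa>2 \<xi>] form by (simp add: D_def D2_def V_def)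
  have "D = 0"
  \<comment> \<open>For \<open>\<kappa>2 \<ge> 0\<close> both terms of the form are nonnegative. For
    \<open>\<kappa>2 < 0\<close> the bound \<open>D2\<close> bounds the form below by
    \<open>(\<kappa>1 + 4 * \<kappa>2) * D\<close>.\<close>
  proof (cases "\<kappa>2 \<ge> 0")
    case True
    then have "\<kappa>1 * D \<le> 0" using zero nonneg by (smt (verit) mult_nonneg_nonneg)
    then show ?thesis using \<kappa> nonneg by (simp add: mult_le_0_iff)
  next
    case False
    then have "\<kappa>2 * (4 * D) \<le> \<kappa>2 * D2" using D2 by (intro mult_left_mono_neg) auto
    then have "(\<kappa>1 + 4 * \<kappa>2) * D \<le> 0" using zero by (simp add: algebra_simps)
    then show ?thesis using \<kappa> nonneg by (simp add: mult_le_0_iff)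
  qed
  then have step: "V (Suc i) = V i" if "i < M" for i
    using that by (simp add: D_def sum_nonneg_eq_0_iff)
  have V0: "V i = V 0" if "i < M" for i
    using that by (induction i) (use step in auto)
  have u: "u i = u 0" if "i < M" for i
    using V0[OF that] that M by (simp add: V_def bloch_extension_def)
  have "(\<Sum>i<M. u i) = (\<Sum>i<M. u 0)" by (intro sum.cong refl u) simp
  then show ?thesis using mean M u[OF \<open>k < M\<close>] by simp
qed

section \<open>The kernel symbol\<close>

lemma symbol_carrier [simp]: "symbol \<kappa>1 \<kappa>2 M \<xi> \<in> carrier_mat M M"
  by (simp add: symbol_def diag_block_def subdiag_block_def)

lemma trig_rational_mat_symbol: "trig_rational_mat M M (symbol \<kappa>1 \<kappa>2 M)"
  by (rule trig_rational_matI)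
     (simp_all add: symbol_index trig_rational_add trig_rational_mult trig_rational_const
       trig_rational_cis trig_rational_cis_minus del: cis_inverse)

text \<open>Both facts are read off the Gram matrix of the full orthogonal matrix: its column 0 is
  constant, so orthogonality to it means zero column sums, and column \<open>b\<close> of
  \<open>Q2\<close> sits at \<open>Suc b\<close>.\<close>

lemma is_complement_orthonormal:
  assumes M: "M \<ge> 2" and Q2: "is_complement M Q2"
  shows "\<And>b. b < M - 1 \<Longrightarrow> (\<Sum>i<M. Q2 $$ (i, b)) = 0"
    and "transpose_mat Q2 * Q2 = 1\<^sub>m (M - 1)"
proof -
  define U where "U = append_cols (avg_col M) Q2"
  have Q: "Q2 \<in> carrier_mat M (M - 1)" and UU: "transpose_mat U * U = 1\<^sub>m M"
    and UC: "U \<in> carrier_mat M M"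
    using Q2 by (auto simp: is_complement_def is_orthogonal_matrix_def U_def)
  have U0: "U $$ (i, 0) = 1 / sqrt (real M)" if "i < M" for i
    using that Q by (simp add: U_def append_cols_def avg_col_def)
  have US: "U $$ (i, Suc b) = Q2 $$ (i, b)" if "i < M" "b < M - 1" for i b
    using that Q by (simp add: U_def append_cols_def avg_col_def)
  have gram: "(\<Sum>i<M. U $$ (i, a) * U $$ (i, b)) = of_bool (a = b)" if "a < M" "b < M" for a b
    using arg_cong[OF UU, of "\<lambda>A. A $$ (a, b)"] that UC
    by (simp add: scalar_prod_def lessThan_atLeast0)
  show "(\<Sum>i<M. Q2 $$ (i, b)) = 0" if "b < M - 1" for b
  proof -
    have "(1 / sqrt (real M)) * (\<Sum>i<M. Q2 $$ (i, b)) = (\<Sum>i<M. U $$ (i, 0) * U $$ (i, Suc b))"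
      unfolding sum_distrib_left using that by (intro sum.cong refl) (simp add: U0 US)
    also have "\<dots> = 0" using gram[of 0 "Suc b"] that M by simp
    finally show ?thesis using M by simp
  qed
  show "transpose_mat Q2 * Q2 = 1\<^sub>m (M - 1)"
  proof (rule eq_matI)
    fix a b assume "a < dim_row (1\<^sub>m (M - 1) :: real mat)" "b < dim_col (1\<^sub>m (M - 1) :: real mat)"
    then have ab: "a < M - 1" "b < M - 1" by auto
    have "(transpose_mat Q2 * Q2) $$ (a, b) = (\<Sum>i<M. U $$ (i, Suc a) * U $$ (i, Suc b))"
      using ab Q by (simp add: scalar_prod_def lessThan_atLeast0 US)
    also have "\<dots> = of_bool (a = b)" using gram[of "Suc a" "Suc b"] ab by simp
    finally show "(transpose_mat Q2 * Q2) $$ (a, b) = 1\<^sub>m (M - 1) $$ (a, b)" using ab by simp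
  qed (use Q in auto)
qed

text \<open>A kernel vector \<open>v\<close> of the compressed symbol gives a mean-zero vector
  \<open>w\<close>, the image of \<open>v\<close> under \<open>Q2\<close>, on which the form of the
  symbol vanishes. Definiteness yields \<open>w = 0\<close>.\<close>

lemma compressed_symbol_det_nonzero:
  assumes M: "M \<ge> 2" and \<kappa>: "\<kappa>1 > 0" "\<kappa>1 + 4 * \<kappa>2 > 0" and Q2: "is_complement M Q2"
  shows "Determinant.det (transpose_mat (cmat Q2) * symbol \<kappa>1 \<kappa>2 M \<xi> * cmat Q2) \<noteq> 0" (is "Determinant.det ?B \<noteq> 0")
proof
  let ?A = "symbol \<kappa>1 \<kappa>2 M \<xi>" and ?R = "cmat Q2"
  have Q: "Q2 \<in> carrier_mat M (M - 1)" using Q2 by (simp add: is_complement_def)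
  then have R: "?R \<in> carrier_mat M (M - 1)" "transpose_mat ?R \<in> carrier_mat (M - 1) M" by auto
  have B: "?B \<in> carrier_mat (M - 1) (M - 1)"
    by (rule mult_carrier_mat[OF mult_carrier_mat[OF R(2) symbol_carrier] R(1)])
  assume "Determinant.det ?B = 0"
  then obtain v where v: "v \<in> carrier_vec (M - 1)" "v \<noteq> 0\<^sub>v (M - 1)" "?B *\<^sub>v v = 0\<^sub>v (M - 1)"
    using det_0_iff_vec_prod_zero_field[OF B] by blast
  define w where "w = ?R *\<^sub>v v"
  define u where "u i = vec_index w i" for i
  have w: "w \<in> carrier_vec M" using R v by (simp add: w_def)
  have u: "u i = (\<Sum>b<M - 1. of_real (Q2 $$ (i, b)) * vec_index v b)" if "i < M" for i
    using that Q v(1) by (simp add: u_def w_def scalar_prod_def lessThan_atLeast0)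
  have mean: "(\<Sum>i<M. u i) = 0"
  proof -
    have "(\<Sum>i<M. u i) = (\<Sum>i<M. \<Sum>b<M - 1. of_real (Q2 $$ (i, b)) * vec_index v b)"
      by (intro sum.cong refl) (simp only: u lessThan_iff)
    also have "\<dots> = (\<Sum>b<M - 1. of_real (\<Sum>i<M. Q2 $$ (i, b)) * vec_index v b)"
      by (subst sum.swap) (simp add: sum_distrib_right)
    also have "\<dots> = 0" using is_complement_orthonormal(1)[OF M Q2] by (simp del: of_real_sum)
    finally show ?thesis .
  qed
  have proj: "transpose_mat ?R *\<^sub>v (?A *\<^sub>v w) = 0\<^sub>v (M - 1)"
    using v(3) unfolding assoc_mult_mat_vec[OF mult_carrier_mat[OF R(2) symbol_carrier] R(1) v(1)]
      w_def[symmetric] assoc_mult_mat_vec[OF R(2) symbol_carrier w] .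
  have proj_b: "(\<Sum>i<M. of_real (Q2 $$ (i, b)) * (\<Sum>j<M. ?A $$ (i, j) * u j)) = 0" if "b < M - 1" for b
  proof -
    have "vec_index (?A *\<^sub>v w) i = (\<Sum>j<M. ?A $$ (i, j) * u j)" if "i < M" for i
      using that w symbol_carrier[of \<kappa>1 \<kappa>2 M \<xi>] unfolding carrier_mat_def carrier_vec_def
      by (simp add: scalar_prod_def lessThan_atLeast0 u_def)
    then have "(\<Sum>i<M. of_real (Q2 $$ (i, b)) * (\<Sum>j<M. ?A $$ (i, j) * u j))
      = vec_index (transpose_mat ?R *\<^sub>v (?A *\<^sub>v w)) b"
      using that Q w symbol_carrier[of \<kappa>1 \<kappa>2 M \<xi>] unfolding carrier_mat_def carrier_vec_def
      by (simp add: scalar_prod_def lessThan_atLeast0 cong: sum.cong_simp)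
    then show ?thesis using proj that by simp
  qed
  have "(\<Sum>i<M. \<Sum>j<M. cnj (u i) * ?A $$ (i, j) * u j)
      = (\<Sum>i<M. cnj (u i) * (\<Sum>j<M. ?A $$ (i, j) * u j))"
    by (simp add: sum_distrib_left mult.assoc)
  \<comment> \<open>The entries of \<open>Q2\<close> are real, so conjugating \<open>u\<close>
    conjugates only the coefficients in \<open>v\<close>; the form becomes a combination of the sums
    that vanish by \<open>proj_b\<close>.\<close>
  also have "\<dots> = (\<Sum>i<M. \<Sum>b<M - 1. cnj (vec_index v b) *
      (of_real (Q2 $$ (i, b)) * (\<Sum>j<M. ?A $$ (i, j) * u j)))"
  proof (intro sum.cong refl)
    fix i assume "i \<in> {..<M}"
    then have "cnj (u i) = (\<Sum>b<M - 1. cnj (vec_index v b) * of_real (Q2 $$ (i, b)))"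
      by (simp add: u mult.commute)
    then show "cnj (u i) * (\<Sum>j<M. ?A $$ (i, j) * u j) =
      (\<Sum>b<M - 1. cnj (vec_index v b) * (of_real (Q2 $$ (i, b)) * (\<Sum>j<M. ?A $$ (i, j) * u j)))"
      by (simp only: sum_distrib_right mult.assoc)
  qed
  also have "\<dots> = (\<Sum>b<M - 1. cnj (vec_index v b) *
      (\<Sum>i<M. of_real (Q2 $$ (i, b)) * (\<Sum>j<M. ?A $$ (i, j) * u j)))"
    by (subst sum.swap) (simp only: sum_distrib_left)
  also have "\<dots> = 0" using proj_b by simp
  finally have "u i = 0" if "i < M" for i
    using symbol_definite_on_mean_zero[OF M \<kappa> _ mean that] by blast
  then have "w = 0\<^sub>v M" using w by (intro eq_vecI) (auto simp: u_def)
  \<comment> \<open>Orthonormality of the columns of \<open>Q2\<close> recovers \<open>v\<close>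
    from \<open>w\<close>, so \<open>v\<close> would be zero.\<close>
  then have "0\<^sub>v (M - 1) = transpose_mat ?R *\<^sub>v (?R *\<^sub>v v)"
    unfolding w_def[symmetric] \<open>w = 0\<^sub>v M\<close> using R(2) by (intro eq_vecI) auto
  also have "\<dots> = (transpose_mat ?R * ?R) *\<^sub>v v" using R v(1) by simp
  also have "transpose_mat ?R * ?R = cmat (transpose_mat Q2 * Q2)"
  proof -
    have "transpose_mat ?R = cmat (transpose_mat Q2)" by (rule eq_matI) auto
    moreover have "cmat (transpose_mat Q2 * Q2) = cmat (transpose_mat Q2) * ?R"
      by (rule of_real_hom.mat_hom_mult[OF transpose_carrier_mat[THEN iffD2, OF Q] Q])
    ultimately show ?thesis by simp
  qed
  also have "\<dots> = 1\<^sub>m (M - 1)"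
    unfolding is_complement_orthonormal(2)[OF M Q2] by (rule of_real_hom.mat_hom_one)
  finally show False using v by simp
qed

lemma trig_rational_kernel_symbol:
  assumes "M \<ge> 2" "\<kappa>1 > 0" "\<kappa>1 + 4 * \<kappa>2 > 0" "is_complement M Q2"
  shows "trig_rational (kernel_symbol \<kappa>1 \<kappa>2 M Q2)"
proof -
  have R2: "cmat Q2 \<in> carrier_mat M (M - 1)" "transpose_mat (cmat Q2) \<in> carrier_mat (M - 1) M"
    using assms(4) by (auto simp: is_complement_def)
  have R1: "cmat (avg_col M) \<in> carrier_mat M 1" "transpose_mat (cmat (avg_col M)) \<in> carrier_mat 1 M"
    by (auto simp: avg_col_def)
  \<comment> \<open>The facts \<open>const(1)\<close> to \<open>const(4)\<close> concern, in this
    order, the averaging column, its transpose, \<open>Q2\<close> and its transpose.\<close>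
  note mult = trig_rational_mat_mult
    and const = R1[THEN trig_rational_mat_const] R2[THEN trig_rational_mat_const]
  have "trig_rational_mat (M - 1) (M - 1) (\<lambda>x. transpose_mat (cmat Q2) * symbol \<kappa>1 \<kappa>2 M x * cmat Q2)"
    by (rule mult[OF mult[OF const(4) trig_rational_mat_symbol] const(3)])
  then have inv: "trig_rational_mat (M - 1) (M - 1)
      (\<lambda>x. the (mat_inverse (transpose_mat (cmat Q2) * symbol \<kappa>1 \<kappa>2 M x * cmat Q2)))"
    by (rule trig_rational_mat_inverse) (rule compressed_symbol_det_nonzero[OF assms])
  show ?thesis
    unfolding kernel_symbol_def Let_def
    by (rule trig_rational_matD(2)[OF mult[OF mult[OF
          mult[OF mult[OF const(2) trig_rational_mat_symbol] const(3)] inv]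
          mult[OF mult[OF const(4) trig_rational_mat_symbol] const(1)]]]) simp_all
qed

theorem theorem3:
  fixes \<kappa>1 \<kappa>2 :: real and M n :: nat and Q2 :: "real mat"
  assumes "M \<ge> 2"
    and "\<kappa>1 > 0" and "\<kappa>1 + 4 * \<kappa>2 > 0"
    and "is_complement M Q2"
    and "n > 0"
  shows "(\<lambda>J. norm (memory_kernel0 \<kappa>1 \<kappa>2 M Q2 J))
           \<in> o[filtercomap (\<lambda>J::int. \<bar>J\<bar>) at_top](\<lambda>J. real_of_int \<bar>J\<bar> powi (- int n))"
proof -
  \<comment> \<open>This puts the integrand into the form of the Fourier estimate; the prefactor
    \<open>1 / (2 * of_real pi)\<close> becomes its constant \<open>c\<close>.\<close>
  have "exp (\<i> * of_int J * of_real x) = cis (of_int J * x)" for J x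
    by (simp add: cis_conv_exp mult.assoc)
  then show ?thesis
    using trig_rational_fourier_smallo[OF trig_rational_kernel_symbol[OF assms(1-4)]]
    unfolding memory_kernel0_def by (simp only:)
qed

end
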